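(* For every natural number $n$, let $a(n)=\sum_{d\mid n,\ 1\le d\le\sqrt{n}} d$, the sum of the positive divisors of $n$ not exceeding $\sqrt{n}$. Then $a(n)$ is of average order $\sqrt{n}$; more precisely, $$\sum_{k=1}^n a(k)=\frac23 n\sqrt{n} + O(n\ln n)\quad\text{as } n\to\infty.$$
   Context: An arithmetic function $f(n)$ is said to be of average order $g(n)$ if $\sum_{k=1}^n f(k)\sim\sum_{k=1}^n g(k)$ as $n\to\infty$, where $F\sim G$ means $\lim F/G=1$. The notation $F(n)=O(G(n))$ means $|F(n)|\le C|G(n)|$ for some constant $C>0$ independent of $n$, for all sufficiently large $n$. *)

theory Defs
  imports Complex_Main "HOL-Library.Landau_Symbols"
begin

definition has_average_order :: "(nat \<Rightarrow> real) \<Rightarrow> (nat \<Rightarrow> real) \<Rightarrow> bool" where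
  "has_average_order f g \<longleftrightarrow> (\<lambda>n. \<Sum>k=1..n. f k) \<sim>[at_top] (\<lambda>n. \<Sum>k=1..n. g k)"

definition small_divisor_sum :: "nat \<Rightarrow> nat" where
  "small_divisor_sum n = (\<Sum>d | d dvd n \<and> 1 \<le> d \<and> real d \<le> sqrt (real n). d)"

end

theory Submission
  imports Defs "HOL-Library.Discrete_Functions" "HOL-Real_Asymp.Real_Asymp"
begin

text \<open>
  Exchanging the order of summation, a divisor \<open>d \<le> \<surd>n\<close> contributes \<open>d\<close> once for each of its
  multiples \<open>k = d q \<le> n\<close> with \<open>q \<ge> d\<close>, that is \<open>d (\<lfloor>n/d\<rfloor> - d + 1)\<close> in total. Since
  \<open>d \<lfloor>n/d\<rfloor> = n - (n mod d)\<close>, with \<open>m = \<lfloor>\<surd>n\<rfloor>\<close> the sum is \<open>m n - m^3/3 + O(n)\<close>, and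
  \<open>m n - m^3/3 = 2/3 n\<surd>n - (\<surd>n - m)^2 (2\<surd>n + m)/3\<close>. The error is thus even \<open>O(n)\<close>.
\<close>

text \<open>The multiples are \<open>d * q\<close> with \<open>d \<le> q \<le> n div d\<close>.
  Truncated subtraction agrees with the empty range when \<open>n div d < d\<close>.\<close>

lemma card_multiples_ge_square:
  fixes d n :: nat
  assumes "1 \<le> d"
  shows "card {k \<in> {1..n}. d dvd k \<and> d\<^sup>2 \<le> k} = n div d + 1 - d"
proof -
  have "{k \<in> {1..n}. d dvd k \<and> d\<^sup>2 \<le> k} = (*) d ` {d..n div d}"
    using assms
    by (auto simp: power2_eq_square less_eq_div_iff_mult_less_eq mult.commute image_iff elim!: dvdE)
  moreover have "inj_on ((*) d) {d..n div d}"
    using assms by (auto simp: inj_on_def)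
  ultimately show ?thesis
    by (simp add: card_image)
qed

lemma small_divisor_sum_altdef:
  "small_divisor_sum k = (\<Sum>d | 1 \<le> d \<and> d dvd k \<and> d\<^sup>2 \<le> k. d)"
proof -
  have "real d \<le> sqrt (real k) \<longleftrightarrow> d\<^sup>2 \<le> k" for d
    by (metis of_nat_0_le_iff of_nat_le_iff of_nat_power real_le_rsqrt real_sqrt_le_iff real_sqrt_abs
        abs_of_nat)
  then show ?thesis
    unfolding small_divisor_sum_def by (intro sum.cong) auto
qed

lemma sum_small_divisor_sum:
  "(\<Sum>k=1..n. small_divisor_sum k) = (\<Sum>d=1..floor_sqrt n. d * (n div d + 1 - d))"
proof -
  \<comment> \<open>From \<open>d\<^sup>2 \<le> k \<le> n\<close> follows
    \<open>d \<le> floor_sqrt n\<close>, so adding this bound changes nothing; it makes the range of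
    \<open>d\<close> independent of \<open>k\<close>, as the swap requires.\<close>
  have "(\<Sum>k=1..n. small_divisor_sum k)
      = (\<Sum>k=1..n. \<Sum>d | d \<in> {1..floor_sqrt n} \<and> (d dvd k \<and> d\<^sup>2 \<le> k). d)"
    unfolding small_divisor_sum_altdef
    by (intro sum.cong) (auto simp: le_floor_sqrt_iff)
  also have "\<dots> = (\<Sum>d=1..floor_sqrt n. \<Sum>k | k \<in> {1..n} \<and> (d dvd k \<and> d\<^sup>2 \<le> k). d)"
    by (rule sum.swap_restrict) auto
  also have "\<dots> = (\<Sum>d=1..floor_sqrt n. d * (n div d + 1 - d))"
  proof (intro sum.cong refl)
    fix d assume "d \<in> {1..floor_sqrt n}"
    then have "card {k \<in> {1..n}. d dvd k \<and> d\<^sup>2 \<le> k} = n div d + 1 - d"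
      by (intro card_multiples_ge_square) simp
    then show "(\<Sum>k | k \<in> {1..n} \<and> (d dvd k \<and> d\<^sup>2 \<le> k). d) = d * (n div d + 1 - d)"
      by simp
  qed
  finally show ?thesis .
qed

lemma real_sum_small_divisor_sum:
  defines "m \<equiv> floor_sqrt"
  shows "(\<Sum>k=1..n. real (small_divisor_sum k))
    = real (m n) * real n - (\<Sum>d=1..m n. real d ^ 2) + (\<Sum>d=1..m n. real d)
        - (\<Sum>d=1..m n. real (n mod d))"
proof -
  have "real (d * (n div d + 1 - d)) = real n - real d ^ 2 + real d - real (n mod d)"
    if "d \<in> {1..m n}" for d
  proof -
    from that have d: "1 \<le> d" "d\<^sup>2 \<le> n"
      by (auto simp: m_def le_floor_sqrt_iff)
    \<comment> \<open>This makes the truncated subtraction exact, so it can be carried over to the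
      reals.\<close>
    then have "d \<le> n div d"
      by (simp add: less_eq_div_iff_mult_less_eq power2_eq_square)
    then have "real (d * (n div d + 1 - d)) = real (d * (n div d)) + real d - real d ^ 2"
      by (simp only: of_nat_mult of_nat_diff[OF trans_le_add1] of_nat_add)
        (simp add: algebra_simps power2_eq_square)
    moreover have "real (d * (n div d)) = real n - real (n mod d)"
      by (metis add_diff_cancel_right' mult_div_mod_eq of_nat_add)
    ultimately show ?thesis by simp
  qed
  then have "(\<Sum>d=1..m n. real (d * (n div d + 1 - d)))
      = (\<Sum>d=1..m n. real n - real d ^ 2 + real d - real (n mod d))"
    by (intro sum.cong) auto
  moreover have "(\<Sum>k=1..n. real (small_divisor_sum k)) = (\<Sum>d=1..m n. real (d * (n div d + 1 - d)))"
    using arg_cong[OF sum_small_divisor_sum, of real n] unfolding m_def by (simp only: of_nat_sum)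
  ultimately show ?thesis
    by (simp add: sum.distrib sum_subtractf)
qed

lemma sum_real_upto: "(\<Sum>d=1..m. real d) = real m * (real m + 1) / 2"
  by (induction m) (auto simp: field_simps)

lemma sum_real_squares_upto:
  "(\<Sum>d=1..m. real d ^ 2) = real m * (real m + 1) * (2 * real m + 1) / 6"
  by (induction m) (auto simp: field_simps power2_eq_square)

text \<open>The error is exactly \<open>m / 3 - r - e\<close>, where \<open>r\<close> collects the
  remainders and \<open>e\<close> the rounding of the square root. Only \<open>r\<close> can have
  order \<open>n\<close>; the other two are at most \<open>s = sqrt n\<close>.\<close>

lemma sum_small_divisor_sum_error_bound:
  "\<bar>(\<Sum>k=1..n. real (small_divisor_sum k)) - 2 / 3 * real n * sqrt (real n)\<bar> \<le> 2 * real n"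
proof (cases "n = 0")
  case False
  define s where "s = sqrt (real n)"
  define m where "m = real (floor_sqrt n)"
  define r where "r = (\<Sum>d=1..floor_sqrt n. real (n mod d))"
  have n: "real n = s\<^sup>2" and s: "1 \<le> s"
    using False by (auto simp: s_def)
  have "m\<^sup>2 \<le> real n"
    unfolding m_def of_nat_power[symmetric] of_nat_le_iff by (rule floor_sqrt_power2_le)
  then have ms: "m \<le> s"
    by (simp add: s_def real_le_rsqrt)
  have "real n < real ((Suc (floor_sqrt n))\<^sup>2)"
    unfolding of_nat_less_iff by (rule Suc_floor_sqrt_power2_gt)
  then have "s < m + 1"
    unfolding n by (intro power_less_imp_less_base[of s 2]) (auto simp: m_def add_ac)
  then have sm: "(s - m)\<^sup>2 \<le> 1"
    using ms by (simp add: abs_square_le_1)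
  have m: "0 \<le> m" by (simp add: m_def)
  have "r \<le> (\<Sum>d=1..floor_sqrt n. real d)"
    unfolding r_def by (intro sum_mono) (auto intro: less_imp_le)
  then have r: "0 \<le> r" "r \<le> m * (m + 1) / 2"
    unfolding sum_real_upto m_def[symmetric] by (auto simp: r_def intro: sum_nonneg)
  \<comment> \<open>Squares minus linear terms sum to \<open>m^3 / 3 - m / 3\<close>, and
    \<open>m * s^2 - m^3 / 3 = 2 / 3 * s^3 - e\<close>. The double root at \<open>m = s\<close>
    keeps \<open>e\<close> small.\<close>
  define e where "e = (s - m)\<^sup>2 * (2 * s + m) / 3"
  have "(\<Sum>k=1..n. real (small_divisor_sum k)) - 2 / 3 * real n * sqrt (real n)
      = m * s\<^sup>2 - m * (m + 1) * (2 * m + 1) / 6 + m * (m + 1) / 2 - r - 2 / 3 * s\<^sup>2 * s"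
    unfolding real_sum_small_divisor_sum sum_real_upto sum_real_squares_upto
    by (simp add: m_def r_def n[symmetric]) (simp add: s_def)
  also have "\<dots> = m / 3 - r - e"
    by (simp add: e_def field_simps power2_eq_square)
  finally have eq: "(\<Sum>k=1..n. real (small_divisor_sum k)) - 2 / 3 * real n * sqrt (real n)
      = m / 3 - r - e" .
  have "(s - m)\<^sup>2 * (2 * s + m) \<le> 1 * (2 * s + m)"
    using sm s m by (intro mult_right_mono) auto
  also have "\<dots> \<le> 3 * s"
    using ms by simp
  finally have e: "0 \<le> e" "e \<le> s"
    using s m ms by (simp_all add: e_def)
  \<comment> \<open>These give \<open>r \<le> s^2\<close> and \<open>e \<le> s^2\<close>, hence the
    constant 2.\<close>
  have "s \<le> s\<^sup>2" "m * m \<le> s\<^sup>2"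
    using s m ms by (auto simp: power2_eq_square intro: mult_mono)
  then have "\<bar>m / 3 - r - e\<bar> \<le> 2 * s\<^sup>2"
    using r e m ms by (auto simp: abs_le_iff algebra_simps)
  then show ?thesis
    unfolding eq by (simp only: n)
qed auto

text \<open>A discrete comparison with the integral of the square root: \<open>3 * sqrt x\<close> is
  the derivative of \<open>2 * x * sqrt x\<close>, so its values at \<open>n\<close> and
  \<open>n + 1\<close> enclose the increment, and the increments telescope.\<close>

lemma sum_sqrt_bounds:
  "2 / 3 * real n * sqrt (real n) \<le> (\<Sum>k=1..n. sqrt (real k))"
  "(\<Sum>k=1..n. sqrt (real k)) \<le> 2 / 3 * real n * sqrt (real n) + sqrt (real n)"
proof -
  have step: "3 * sqrt (real n) \<le> 2 * (real (Suc n) * sqrt (real (Suc n)) - real n * sqrt (real n))"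
    "2 * (real (Suc n) * sqrt (real (Suc n)) - real n * sqrt (real n)) \<le> 3 * sqrt (real (Suc n))" for n
  proof -
    define s t where "s = sqrt (real n)" and "t = sqrt (real (Suc n))"
    have s: "real n = s * s" "0 \<le> s" and t: "real (Suc n) = t * t" "0 < t"
      by (auto simp: s_def t_def)
    have st: "s \<le> t" by (simp add: s_def t_def)
    have "t * t = s * s + 1"
      using s t by simp
    then have 1: "(t - s) * (t + s) = 1"
      by (simp add: algebra_simps)
    have "2 * (t * t * t - s * s * s) = 2 * (t * t + t * s + s * s) * (t - s)"
      by (simp add: algebra_simps)
    \<comment> \<open>Multiplying by \<open>1 = (t + s) * (t - s)\<close> gives all three quantities
      the factor \<open>t - s \<ge> 0\<close>; comparing the cofactors then only takes
      \<open>s * s \<le> s * t \<le> t * t\<close>.\<close>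
    moreover have "3 * s = 3 * s * (t + s) * (t - s)" "3 * t = 3 * t * (t + s) * (t - s)"
      using 1 by (simp_all add: mult.assoc mult.commute[of "t - s"])
    moreover have ss: "s * s \<le> s * t" "s * t \<le> t * t"
      using s(2) t(2) st by (auto intro: mult_mono)
    moreover have "3 * s * (t + s) * (t - s) \<le> 2 * (t * t + t * s + s * s) * (t - s)"
      using ss st by (intro mult_right_mono) (auto simp: algebra_simps)
    moreover have "2 * (t * t + t * s + s * s) * (t - s) \<le> 3 * t * (t + s) * (t - s)"
      using ss st by (intro mult_right_mono) (auto simp: algebra_simps)
    ultimately have "3 * s \<le> 2 * (t * t * t - s * s * s)" "2 * (t * t * t - s * s * s) \<le> 3 * t"
      by linarith+
    then show "3 * sqrt (real n) \<le> 2 * (real (Suc n) * sqrt (real (Suc n)) - real n * sqrt (real n))"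
      "2 * (real (Suc n) * sqrt (real (Suc n)) - real n * sqrt (real n)) \<le> 3 * sqrt (real (Suc n))"
      unfolding s_def[symmetric] t_def[symmetric] using s(1) t(1) by (simp_all only:)
  qed
  define P where "P n = real n * sqrt (real n)" for n :: nat
  have "2 / 3 * P n \<le> (\<Sum>k=1..n. sqrt (real k)) \<and>
    (\<Sum>k=1..n. sqrt (real k)) \<le> 2 / 3 * P n + sqrt (real n)"
  proof (induction n)
    case (Suc n)
    have "(\<Sum>k=1..Suc n. sqrt (real k)) = (\<Sum>k=1..n. sqrt (real k)) + sqrt (real (Suc n))"
      by simp
    \<comment> \<open>For the upper bound, the old slack \<open>sqrt n\<close> is absorbed by the
      increment of \<open>2 / 3 * P\<close>, and the new term becomes the new slack.\<close>
    moreover note Suc.IH step[of n, folded P_def]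
    ultimately show ?case by argo
  qed (auto simp: P_def)
  then show "2 / 3 * real n * sqrt (real n) \<le> (\<Sum>k=1..n. sqrt (real k))"
    "(\<Sum>k=1..n. sqrt (real k)) \<le> 2 / 3 * real n * sqrt (real n) + sqrt (real n)"
    by (auto simp: P_def)
qed

theorem theorem2p1:
  shows "has_average_order (\<lambda>n. real (small_divisor_sum n)) (\<lambda>n. sqrt (real n)) \<and>
    (\<lambda>n::nat. (\<Sum>k=1..n. real (small_divisor_sum k)) - 2 / 3 * real n * sqrt (real n))
      \<in> O[at_top](\<lambda>n. real n * ln (real n))"
proof -
  define main where "main = (\<lambda>n::nat. 2 / 3 * real n * sqrt (real n))"
  define A where "A = (\<lambda>n. \<Sum>k=1..n. real (small_divisor_sum k))"
  define B where "B = (\<lambda>n. \<Sum>k=1..n. sqrt (real k))"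
  have A: "(\<lambda>n. A n - main n) \<in> O(\<lambda>n. real n)"
    by (intro bigoI[of _ 2] always_eventually allI)
      (use sum_small_divisor_sum_error_bound in \<open>simp add: A_def main_def\<close>)
  have B: "(\<lambda>n. B n - main n) \<in> O(\<lambda>n. sqrt (real n))"
  proof (intro bigoI[of _ 1] always_eventually allI)
    show "norm (B n - main n) \<le> 1 * norm (sqrt (real n))" for n
      using sum_sqrt_bounds[of n] by (simp add: B_def main_def)
  qed
  \<comment> \<open>Both errors are negligible against \<open>main\<close>, so \<open>A\<close> and
    \<open>B\<close> are equivalent through it.\<close>
  have "(\<lambda>n. real n) \<in> o(main)" "(\<lambda>n. sqrt (real n)) \<in> o(main)"
    unfolding main_def by real_asymp+
  then have "A \<sim>[at_top] main" "B \<sim>[at_top] main"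
    using A B by (auto intro: smallo_imp_asymp_equiv landau_o.big_small_trans)
  then have "A \<sim>[at_top] B"
    using asymp_equiv_sym asymp_equiv_trans by blast
  moreover have "(\<lambda>n::nat. real n) \<in> O(\<lambda>n. real n * ln (real n))"
    by real_asymp
  ultimately show ?thesis
    using landau_o.big_trans[OF A] by (simp add: has_average_order_def A_def B_def main_def)
qed

end
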